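(* For every integer $m\ge 0$, $$\sum_{k=1}^\infty (\zeta(2k+1)-1) \frac{F_{2k+m}}{2k+1}= (1-\gamma)F_{m} + \frac{L_{m-1}}{2\sqrt{5}}\Big(\ln\Big(-\pi\sec\frac{\sqrt{5}\,\pi}{2}\Big) - 2\ln\Gamma(\alpha) - 4\ln\alpha\Big)$$ and $$\sum_{k=1}^\infty (\zeta(2k+1)-1) \frac{L_{2k+m}}{2k+1}= (1-\gamma)L_{m} + \frac{\sqrt{5}\, F_{m-1}}{2}\Big(\ln\Big(-\pi\sec\frac{\sqrt{5}\,\pi}{2}\Big) - 2\ln\Gamma(\alpha) - 4\ln\alpha\Big),$$ where $\gamma$ is the Euler-Mascheroni constant and $\alpha=\frac{1+\sqrt5}{2}$.
   Context: $\zeta$ is the Riemann zeta function, $\zeta(s)=\sum_{n\ge1} n^{-s}$ for $\Re(s)>1$; $\Gamma$ is the gamma function; $\gamma=\lim_{n\to\infty}\big(\sum_{k=1}^n \frac1k-\ln n\big)$; $\sec x = 1/\cos x$; $\ln$ is the real natural logarithm. The Fibonacci numbers $F_n$ and Lucas numbers $L_n$ are defined by $F_0=0$, $F_1=1$, $L_0=2$, $L_1=1$, $F_{n+2}=F_{n+1}+F_n$, $L_{n+2}=L_{n+1}+L_n$, and are extended to negative indices by $F_{-n}=(-1)^{n+1}F_n$ and $L_{-n}=(-1)^nL_n$ (so $F_{-1}=1$, $L_{-1}=-1$). *)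

theory Defs
  imports "HOL-Analysis.Analysis" "HOL-Number_Theory.Fib"
begin

text \<open>The Dirichlet series of the Riemann zeta function. It is meaningful only for
  \<open>Re s > 1\<close>; no analytic continuation is performed, and values of this constant outside
  that half-plane carry no information.\<close>

definition zeta :: "complex \<Rightarrow> complex" where
  "zeta s = (\<Sum>n. of_nat (Suc n) powr (- s))"

definition sec :: "real \<Rightarrow> real" where
  "sec x = 1 / cos x"

definition golden_ratio :: real where
  "golden_ratio = (1 + sqrt 5) / 2"

definition fib_int :: "int \<Rightarrow> int" where
  "fib_int n = (if n \<ge> 0 then int (fib (nat n))
                else (- 1) ^ (nat (- n) + 1) * int (fib (nat (- n))))"

fun lucas :: "nat \<Rightarrow> nat" where
  "lucas 0 = 2"
| "lucas (Suc 0) = 1"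
| "lucas (Suc (Suc n)) = lucas (Suc n) + lucas n"

definition lucas_int :: "int \<Rightarrow> int" where
  "lucas_int n = (if n \<ge> 0 then int (lucas (nat n))
                  else (- 1) ^ nat (- n) * int (lucas (nat (- n))))"

end

theory Submission
  imports Defs
begin

text \<open>
  Write \<open>G(x)\<close> for the odd power series whose coefficient at \<open>x\<^sup>2\<^sup>k\<^sup>+\<^sup>1\<close> is
  \<open>(\<zeta>(2k+1) - 1)/(2k+1)\<close>, \<open>k \<ge> 1\<close>. Expanding \<open>\<zeta>(2k+1) - 1\<close> as the sum of \<open>n\<close> to the power
  \<open>-(2k+1)\<close> over \<open>n \<ge> 2\<close> and summing over \<open>k\<close> first turns \<open>G(x)\<close> into the sum of
  \<open>artanh (x/n) - x/n\<close> over \<open>n \<ge> 2\<close>. Up to linear terms the partial sums of the latter are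
  half the difference of Euler's sequences for \<open>ln \<Gamma>(2 - x)\<close> and \<open>ln \<Gamma>(2 + x)\<close>, so that for
  \<open>\<bar>x\<bar> < 2\<close> (lemma \<open>odd_zeta_power_series\<close>)
  \<open>G(x) = (1 - \<gamma>) x + (ln \<Gamma>(2 - x) - ln \<Gamma>(2 + x)) / 2\<close>.

  By Binet's formulas the two series of the theorem are the combinations
  \<open>(\<alpha>\<^sup>m\<^sup>-\<^sup>1 G(\<alpha>) - \<beta>\<^sup>m\<^sup>-\<^sup>1 G(\<beta>)) / \<surd>5\<close> and \<open>\<alpha>\<^sup>m\<^sup>-\<^sup>1 G(\<alpha>) + \<beta>\<^sup>m\<^sup>-\<^sup>1 G(\<beta>)\<close>, where
  \<open>\<beta> = 1 - \<alpha>\<close> is the conjugate of the golden ratio \<open>\<alpha>\<close>. As \<open>2 - \<alpha> = 1 + \<beta>\<close> and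
  \<open>2 - \<beta> = 1 + \<alpha>\<close>, the values \<open>G(\<alpha>)\<close> and \<open>G(\<beta>)\<close> involve the same Gamma values, up to the
  factors \<open>1 + \<alpha> = \<alpha>\<^sup>2\<close> and \<open>1 + \<beta> = \<beta>\<^sup>2\<close> from the functional equation. Since
  \<open>\<alpha>\<^sup>2 \<beta>\<^sup>2 = 1\<close>, the logarithmic parts of \<open>G(\<alpha>)\<close> and \<open>G(\<beta>)\<close> are exactly opposite
  (lemma \<open>ln_Gamma_golden_diff\<close>), and so the Fibonacci combination produces a Lucas number in
  front of them and vice versa. The reflection formula at \<open>\<alpha>\<close>, where
  \<open>sin (\<pi> \<alpha>) = cos (\<surd>5 \<pi> / 2)\<close>, eliminates \<open>\<Gamma>(1 + \<beta>)\<close> and brings in the secant.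
\<close>

section \<open>Interchange of nonnegative double series\<close>

lemma sums_swap_nonneg:
  fixes f :: "nat \<Rightarrow> nat \<Rightarrow> real"
  assumes nonneg: "\<And>n k. f n k \<ge> 0"
    and rows: "\<And>n. f n sums r n"
    and cols: "\<And>k. (\<lambda>n. f n k) sums c k"
    and total: "r sums S"
  shows "c sums S"
proof -
  have r: "((\<lambda>k. f n k) has_sum r n) UNIV" for n
    using rows nonneg by (intro sums_nonneg_imp_has_sum) auto
  have c: "((\<lambda>n. f n k) has_sum c k) UNIV" for k
    using cols nonneg by (intro sums_nonneg_imp_has_sum) auto
  have "r n \<ge> 0" for n
    using rows nonneg sums_le[of "\<lambda>_. 0" "f n" 0 "r n"] by auto
  hence R: "(r has_sum S) UNIV"
    using total by (intro sums_nonneg_imp_has_sum) auto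
  have "(\<lambda>(n, k). f n k) summable_on UNIV \<times> UNIV"
    using r R nonneg by (intro summable_on_SigmaI[where g = r]) (auto simp: summable_on_def)
  hence "((\<lambda>(n, k). f n k) has_sum S) (UNIV \<times> UNIV)"
    using r R by (intro has_sum_SigmaI[where g = r]) auto
  hence "((\<lambda>(k, n). f n k) has_sum S) (UNIV \<times> UNIV)"
    by (subst (asm) has_sum_swap) simp
  hence "(c has_sum S) UNIV"
    by (rule has_sum_SigmaD) (use c in auto)
  thus ?thesis
    by (rule has_sum_imp_sums)
qed

section \<open>The odd zeta series and the log-Gamma function\<close>

text \<open>
  The limit is \<open>artanh y - y\<close>: omitting the linear term of the artanh series leaves
  \<open>O(y\<^sup>3)\<close>, which is what makes the later sum over \<open>y = x/n\<close> converge.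
\<close>

lemma artanh_tail_sums:
  fixes y :: real
  assumes "\<bar>y\<bar> < 1"
  shows "(\<lambda>k. y ^ (2 * k + 3) / real (2 * k + 3)) sums (ln ((1 + y) / (1 - y)) / 2 - y)"
proof -
  have "(1 + y) / (1 - y) > 0"
    using assms by (intro divide_pos_pos) auto
  from ln_series_quadratic[OF this]
  have *: "(\<lambda>n. 2 * (((1 + y) / (1 - y) - 1) / ((1 + y) / (1 - y) + 1)) ^ (2 * n + 1) / real (2 * n + 1))
         sums ln ((1 + y) / (1 - y))" .
  have "((1 + y) / (1 - y) - 1) / ((1 + y) / (1 - y) + 1) = y"
    using assms by (simp add: field_simps)
  hence "(\<lambda>n. 2 * (y ^ (2 * n + 1) / real (2 * n + 1))) sums ln ((1 + y) / (1 - y))"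
    using * by simp
  hence "(\<lambda>n. y ^ (2 * n + 1) / real (2 * n + 1)) sums (ln ((1 + y) / (1 - y)) / 2)"
    by (rule sums_mult_D) simp
  hence "(\<lambda>n. y ^ (2 * Suc n + 1) / real (2 * Suc n + 1)) sums (ln ((1 + y) / (1 - y)) / 2 - y)"
    by (subst sums_Suc_iff) simp
  thus ?thesis
    by (simp add: eval_nat_numeral)
qed

text \<open>
  Euler's sequence at an argument shifted by 2. In this form the terms that do not depend
  on the sign of \<open>z\<close> visibly cancel in the difference of the sequences for \<open>z\<close> and \<open>-z\<close>.
\<close>

lemma ln_Gamma_series_plus_2:
  fixes z :: real
  assumes "z > -2" "N > 0"
  shows "ln_Gamma_series (2 + z) N =
           (2 + z) * ln (real N) + ln (fact N) - (\<Sum>k<Suc N. ln (real k + 2 + z))"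
proof -
  have "ln ((2 + z) / real k + 1) = ln (real k + 2 + z) - ln (real k)" if "k \<in> {1..N}" for k
  proof -
    have "(2 + z) / real k + 1 = (real k + 2 + z) / real k"
      using that by (simp add: field_simps)
    thus ?thesis
      using that assms by (simp add: ln_div)
  qed
  hence "(\<Sum>k=1..N. ln ((2 + z) / real k + 1)) = (\<Sum>k=1..N. ln (real k + 2 + z) - ln (real k))"
    by (intro sum.cong refl)
  also have "\<dots> = (\<Sum>k=1..N. ln (real k + 2 + z)) - ln (fact N)"
    by (simp add: sum_subtractf fact_prod ln_prod [of "{1..N}" real, simplified])
  also have "(\<Sum>k=1..N. ln (real k + 2 + z)) = (\<Sum>k<Suc N. ln (real k + 2 + z)) - ln (2 + z)"
    by (simp add: sum.atLeast1_atMost_eq lessThan_Suc_atMost sum.atMost_shift del: sum.lessThan_Suc)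
  finally show ?thesis
    by (simp add: ln_Gamma_series_def)
qed

text \<open>
  The logarithms in the \<open>N\<close>-th partial sum equal half the difference of Euler's sequences
  at \<open>2 - x\<close> and \<open>2 + x\<close> plus \<open>x ln N\<close>. The linear terms add up to \<open>-x (H - 1)\<close> with a harmonic number
  \<open>H\<close> (the index starts at 2), and \<open>ln N - H\<close> tends to \<open>-\<gamma>\<close>.
\<close>

lemma artanh_differences_sums_ln_Gamma:
  fixes x :: real
  assumes "\<bar>x\<bar> < 2"
  shows "(\<lambda>n. ln ((real n + 2 + x) / (real n + 2 - x)) / 2 - x / (real n + 2))
           sums ((1 - euler_mascheroni) * x + (ln_Gamma (2 - x) - ln_Gamma (2 + x)) / 2)"
    (is "?f sums ?S")
proof -
  (* This is the partial sum of the first N + 1 terms, arranged into convergent pieces; its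
     harmonic number has index N + 2, hence the two additional reciprocals. *)
  let ?g = "\<lambda>N. x - x * (harm N - ln (real N)) - x * inverse (real (Suc N)) - x * inverse (real (Suc (Suc N)))
                + (ln_Gamma_series (2 - x) N - ln_Gamma_series (2 + x) N) / 2"
  have "?g \<longlonglongrightarrow> x - x * euler_mascheroni - x * 0 - x * 0 + (ln_Gamma (2 - x) - ln_Gamma (2 + x)) / 2"
    using assms
    by (intro tendsto_intros ln_Gamma_real_LIMSEQ euler_mascheroni_LIMSEQ LIMSEQ_inverse_real_of_nat
          LIMSEQ_Suc[OF LIMSEQ_inverse_real_of_nat]) auto
  also have "x - x * euler_mascheroni - x * 0 - x * 0 + (ln_Gamma (2 - x) - ln_Gamma (2 + x)) / 2 = ?S"
    by (simp add: algebra_simps)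
  finally have lim: "?g \<longlonglongrightarrow> ?S" .
  have "?g N = sum ?f {..<Suc N}" if "N > 0" for N
  proof -
    have harm: "(\<Sum>k<Suc N. x / (real k + 2)) = x * (harm (Suc (Suc N)) - 1)"
      unfolding harm_altdef sum.lessThan_Suc_shift[of _ "Suc N"]
      by (simp add: sum_distrib_left field_simps del: sum.lessThan_Suc)
    have "sum ?f {..<Suc N} = (\<Sum>k<Suc N. (ln (real k + 2 + x) - ln (real k + 2 - x)) / 2 - x / (real k + 2))"
      using assms by (intro sum.cong refl) (auto simp: ln_div)
    also have "\<dots> = ((\<Sum>k<Suc N. ln (real k + 2 + x)) - (\<Sum>k<Suc N. ln (real k + 2 - x))) / 2
                       - x * (harm (Suc (Suc N)) - 1)"
      unfolding sum_subtractf harm sum_divide_distrib [symmetric] ..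
    also have "\<dots> = ?g N"
    proof -
      have lower: "ln_Gamma_series (2 - x) N =
              (2 - x) * ln (real N) + ln (fact N) - (\<Sum>k<Suc N. ln (real k + 2 - x))"
        using ln_Gamma_series_plus_2[of "-x" N] assms that by (simp del: sum.lessThan_Suc)
      have upper: "ln_Gamma_series (2 + x) N =
              (2 + x) * ln (real N) + ln (fact N) - (\<Sum>k<Suc N. ln (real k + 2 + x))"
        using ln_Gamma_series_plus_2[of x N] assms that by (simp del: sum.lessThan_Suc)
      show ?thesis
        unfolding lower upper harm_Suc
        by (simp add: algebra_simps add_divide_distrib diff_divide_distrib
              del: sum.lessThan_Suc of_nat_Suc)
    qed
    finally show ?thesis ..
  qed
  hence "eventually (\<lambda>N. ?g N = sum ?f {..<Suc N}) sequentially"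
    using eventually_gt_at_top[of 0] by (rule eventually_mono[rotated])
  with lim have "(\<lambda>N. sum ?f {..<Suc N}) \<longlonglongrightarrow> ?S"
    by (simp add: filterlim_cong del: sum.lessThan_Suc)
  thus ?thesis
    unfolding sums_def by (subst (asm) filterlim_sequentially_Suc)
qed

definition zeta_tail :: "nat \<Rightarrow> real" where
  "zeta_tail p = (\<Sum>n. 1 / real (n + 2) ^ p)"

lemma zeta_tail_sums:
  assumes "p \<ge> 2"
  shows "(\<lambda>n. 1 / real (n + 2) ^ p) sums zeta_tail p"
proof -
  have "summable (\<lambda>n. inverse (real (n + 2) ^ p))"
    using inverse_power_summable[OF assms, where ?'a = real]
    by (subst summable_iff_shift) simp
  thus ?thesis
    by (simp add: zeta_tail_def summable_sums inverse_eq_divide)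
qed

lemma zeta_of_nat_minus_1:
  assumes "p \<ge> 2"
  shows "zeta (of_nat p) - 1 = of_real (zeta_tail p)"
proof -
  have "(\<lambda>n. 1 / real (Suc n + 1) ^ p) sums (zeta_tail p + 1 - 1 / real (0 + 1) ^ p)"
    using zeta_tail_sums[OF assms] by simp
  hence "(\<lambda>n. 1 / real (n + 1) ^ p) sums (zeta_tail p + 1)"
    by (subst (asm) sums_Suc_iff) simp
  hence "(\<lambda>n. complex_of_real (1 / real (n + 1) ^ p)) sums of_real (zeta_tail p + 1)"
    by (rule sums_of_real)
  also have "(\<lambda>n. complex_of_real (1 / real (n + 1) ^ p)) = (\<lambda>n. of_nat (Suc n) powr (- of_nat p))"
  proof
    fix n
    have "(of_nat (Suc n) :: complex) powr of_nat p = of_nat (Suc n) ^ p"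
      using assms by (subst powr_nat') auto
    thus "complex_of_real (1 / real (n + 1) ^ p) = of_nat (Suc n) powr (- of_nat p)"
      by (simp add: powr_minus field_simps)
  qed
  finally show ?thesis
    by (simp add: zeta_def sums_iff)
qed

text \<open>
  For \<open>x \<ge> 0\<close> the double series over \<open>n\<close> and \<open>k\<close> has nonnegative terms, so the order of
  summation can be exchanged; both sides are odd in \<open>x\<close>, which covers negative \<open>x\<close>.
\<close>

theorem odd_zeta_power_series:
  fixes x :: real
  assumes "\<bar>x\<bar> < 2"
  shows "(\<lambda>j. zeta_tail (2 * j + 3) * x ^ (2 * j + 3) / real (2 * j + 3))
           sums ((1 - euler_mascheroni) * x + (ln_Gamma (2 - x) - ln_Gamma (2 + x)) / 2)"
proof -
  have *: "(\<lambda>j. zeta_tail (2 * j + 3) * x ^ (2 * j + 3) / real (2 * j + 3))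
             sums ((1 - euler_mascheroni) * x + (ln_Gamma (2 - x) - ln_Gamma (2 + x)) / 2)"
    if x: "x \<ge> 0" "x < 2" for x :: real
  proof (rule sums_swap_nonneg)
    show "(x / (real n + 2)) ^ (2 * k + 3) / real (2 * k + 3) \<ge> 0" for n k
      using x by simp
    show "(\<lambda>k. (x / (real n + 2)) ^ (2 * k + 3) / real (2 * k + 3))
            sums (ln ((real n + 2 + x) / (real n + 2 - x)) / 2 - x / (real n + 2))" for n
    proof -
      have "(1 + x / (real n + 2)) / (1 - x / (real n + 2)) = (real n + 2 + x) / (real n + 2 - x)"
      proof -
        have "real n + 2 > 0" "real n + 2 - x > 0"
          using x by auto
        hence "1 + x / (real n + 2) = (real n + 2 + x) / (real n + 2)"
          and "1 - x / (real n + 2) = (real n + 2 - x) / (real n + 2)"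
          by (simp_all add: field_simps)
        with \<open>real n + 2 > 0\<close> show ?thesis
          by simp
      qed
      thus ?thesis
        using artanh_tail_sums[of "x / (real n + 2)"] x by simp
    qed
    show "(\<lambda>n. (x / (real n + 2)) ^ (2 * k + 3) / real (2 * k + 3))
            sums (zeta_tail (2 * k + 3) * x ^ (2 * k + 3) / real (2 * k + 3))" for k
      using sums_mult[OF zeta_tail_sums[of "2 * k + 3"], of "x ^ (2 * k + 3) / real (2 * k + 3)"]
      by (simp add: power_divide field_simps)
    show "(\<lambda>n. ln ((real n + 2 + x) / (real n + 2 - x)) / 2 - x / (real n + 2))
            sums ((1 - euler_mascheroni) * x + (ln_Gamma (2 - x) - ln_Gamma (2 + x)) / 2)"
      using x by (intro artanh_differences_sums_ln_Gamma) auto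
  qed
  show ?thesis
  proof (cases "x \<ge> 0")
    case True
    thus ?thesis using * assms by auto
  next
    case False
    from sums_minus[OF *[of "-x"]] False assms show ?thesis
      by (simp add: algebra_simps diff_divide_distrib)
  qed
qed

section \<open>Binet formulas for integer indices\<close>

abbreviation (input) "\<alpha> \<equiv> golden_ratio"

definition golden_conj :: real where
  "golden_conj = (1 - sqrt 5) / 2"

abbreviation (input) "\<beta> \<equiv> golden_conj"

lemma golden_sum: "\<alpha> + \<beta> = 1"
  and golden_mult: "\<alpha> * \<beta> = -1"
  and golden_sq: "\<alpha>\<^sup>2 = \<alpha> + 1"
  and golden_conj_sq: "\<beta>\<^sup>2 = \<beta> + 1"
  by (auto simp: golden_ratio_def golden_conj_def field_simps power2_eq_square)

lemma golden_bounds: "1 < \<alpha>" "\<alpha> < 2" "-1 < \<beta>" "\<beta> < 0"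
proof -
  have "sqrt 5 > 1" "sqrt 5 < 3"
    by (auto intro!: real_less_rsqrt real_less_lsqrt)
  thus "1 < \<alpha>" "\<alpha> < 2" "-1 < \<beta>" "\<beta> < 0"
    by (auto simp: golden_ratio_def golden_conj_def)
qed

lemma lucas_closed_form: "real (lucas n) = \<alpha> ^ n + \<beta> ^ n"
proof (induction n rule: lucas.induct)
  case (3 n)
  have "\<alpha> ^ Suc (Suc n) + \<beta> ^ Suc (Suc n) = \<alpha>\<^sup>2 * \<alpha> ^ n + \<beta>\<^sup>2 * \<beta> ^ n"
    by (simp add: power2_eq_square)
  also have "\<dots> = (\<alpha> ^ Suc n + \<beta> ^ Suc n) + (\<alpha> ^ n + \<beta> ^ n)"
    by (simp add: golden_sq golden_conj_sq algebra_simps)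
  finally show ?case using 3 by simp
qed (simp_all add: golden_sum)

lemma fib_closed_form_golden: "real (fib n) = (\<alpha> ^ n - \<beta> ^ n) / sqrt 5"
  using fib_closed_form[of n] by (simp add: golden_ratio_def golden_conj_def)

text \<open>
  As \<open>\<alpha> \<beta> = -1\<close>, inversion exchanges the two conjugates up to sign. This is the reason why
  Binet's formulas persist at negative indices with the sign conventions for
  Fibonacci and Lucas numbers.
\<close>

lemma golden_powi_neg:
  assumes "n < 0"
  shows "\<alpha> powi n = (-1) ^ nat (-n) * \<beta> ^ nat (-n)"
    and "\<beta> powi n = (-1) ^ nat (-n) * \<alpha> ^ nat (-n)"
proof -
  have "inverse \<alpha> = - \<beta>" "inverse \<beta> = - \<alpha>"
    using golden_mult golden_bounds by (simp_all add: field_simps)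
  thus "\<alpha> powi n = (-1) ^ nat (-n) * \<beta> ^ nat (-n)"
    and "\<beta> powi n = (-1) ^ nat (-n) * \<alpha> ^ nat (-n)"
    using assms by (auto simp: power_int_def power_minus [of \<alpha>] power_minus [of \<beta>])
qed

lemma fib_int_closed_form: "of_int (fib_int n) = (\<alpha> powi n - \<beta> powi n) / sqrt 5"
proof (cases "n \<ge> 0")
  case True
  thus ?thesis by (simp add: fib_int_def fib_closed_form_golden power_int_def)
next
  case False
  thus ?thesis
    by (simp add: fib_int_def fib_closed_form_golden golden_powi_neg field_simps)
qed

lemma lucas_int_closed_form: "of_int (lucas_int n) = \<alpha> powi n + \<beta> powi n"
proof (cases "n \<ge> 0")
  case True
  thus ?thesis by (simp add: lucas_int_def lucas_closed_form power_int_def)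
next
  case False
  thus ?thesis
    by (simp add: lucas_int_def lucas_closed_form golden_powi_neg field_simps)
qed

section \<open>Log-Gamma differences at the golden ratio\<close>

definition golden_log_const :: real where
  "golden_log_const = ln (- pi * sec (sqrt 5 * pi / 2)) - 2 * ln (Gamma golden_ratio) - 4 * ln golden_ratio"

text \<open>
  The factor \<open>\<alpha>\<close> and the minus sign come from replacing \<open>\<Gamma>(\<beta>)\<close>, whose argument is negative,
  by \<open>\<Gamma>(1 + \<beta>) = \<beta> \<Gamma>(\<beta>)\<close>. All factors on the left are then positive, so logarithms may
  be taken; in particular the argument of the logarithm in the theorem is positive.
\<close>

lemma Gamma_reflection_golden: "Gamma \<alpha> * (\<alpha> * Gamma (1 + \<beta>)) = - pi * sec (sqrt 5 * pi / 2)"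
proof -
  have "complex_of_real (Gamma \<alpha> * Gamma (1 - \<alpha>)) = complex_of_real (pi / sin (pi * \<alpha>))"
    using Gamma_reflection_complex[of "of_real \<alpha>"]
    by (simp flip: Gamma_complex_of_real sin_of_real)
  moreover have "1 - \<alpha> = \<beta>"
    using golden_sum by simp
  ultimately have refl: "Gamma \<alpha> * Gamma \<beta> = pi / sin (pi * \<alpha>)"
    unfolding of_real_eq_iff by simp
  have "pi * \<alpha> = pi / 2 + sqrt 5 * pi / 2"
    by (simp add: golden_ratio_def field_simps)
  hence "sin (pi * \<alpha>) = cos (sqrt 5 * pi / 2)"
    by (simp only: sin_add) simp
  moreover have "\<beta> \<notin> \<int>\<^sub>\<le>\<^sub>0"
  proof
    assume "\<beta> \<in> \<int>\<^sub>\<le>\<^sub>0"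
    then obtain n where n: "\<beta> = of_int n"
      by (auto elim: nonpos_Ints_cases)
    hence "real_of_int (-1) < of_int n" "real_of_int n < of_int 0"
      using golden_bounds by simp_all
    thus False
      unfolding of_int_less_iff by simp
  qed
  hence "Gamma (1 + \<beta>) = \<beta> * Gamma \<beta>"
    using Gamma_plus1[of \<beta>] by (simp add: add.commute)
  moreover have "Gamma \<alpha> * (\<alpha> * (\<beta> * Gamma \<beta>)) = (\<alpha> * \<beta>) * (Gamma \<alpha> * Gamma \<beta>)"
    by (simp only: mult_ac)
  ultimately show ?thesis
    by (simp add: refl golden_mult sec_def)
qed

text \<open>
  Since \<open>\<alpha> + \<beta> = 1\<close>, all four arguments reduce by the functional equation to \<open>\<alpha>\<close> and
  \<open>1 + \<beta>\<close>; the two differences are opposite because \<open>ln (1 + \<beta>) = - ln (1 + \<alpha>)\<close>.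
\<close>

lemma ln_Gamma_golden_diff:
  "ln_Gamma (2 - \<alpha>) - ln_Gamma (2 + \<alpha>) = golden_log_const" (is ?A)
  "ln_Gamma (2 - \<beta>) - ln_Gamma (2 + \<beta>) = - golden_log_const" (is ?B)
proof -
  have a: "\<alpha> > 0" and b: "1 + \<beta> > 0" using golden_bounds by auto
  have shift: "ln_Gamma (z + 1) = ln z + ln_Gamma z" if "z > 0" for z :: real
  proof -
    have "z \<notin> \<int>\<^sub>\<le>\<^sub>0"
      using that by (auto elim!: nonpos_Ints_cases)
    thus ?thesis
      using that by (simp add: Gamma_plus1 ln_Gamma_real_pos ln_mult_pos)
  qed
  have "1 + \<alpha> = \<alpha> * \<alpha>" "(1 + \<beta>) * (\<alpha> * \<alpha>) = 1"
    using golden_sq golden_conj_sq golden_mult by (algebra+)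
  hence ln: "ln (1 + \<alpha>) = 2 * ln \<alpha>" "ln (1 + \<beta>) = - 2 * ln \<alpha>"
    using a b ln_mult[of "1 + \<beta>" "\<alpha> * \<alpha>"] by (auto simp: ln_mult)
  have "ln (- pi * sec (sqrt 5 * pi / 2)) = ln_Gamma \<alpha> + ln \<alpha> + ln_Gamma (1 + \<beta>)"
    unfolding Gamma_reflection_golden [symmetric]
    using a b by (simp add: ln_mult_pos ln_Gamma_real_pos)
  hence const: "golden_log_const = ln_Gamma (1 + \<beta>) - ln_Gamma \<alpha> - 3 * ln \<alpha>"
    using a by (simp add: golden_log_const_def ln_Gamma_real_pos)
  have eqs: "2 - \<alpha> = 1 + \<beta>" "2 + \<alpha> = (1 + \<alpha>) + 1" "2 - \<beta> = 1 + \<alpha>" "2 + \<beta> = (1 + \<beta>) + 1"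
    using golden_sum by auto
  have "ln_Gamma (2 + \<alpha>) = 3 * ln \<alpha> + ln_Gamma \<alpha>"
    unfolding eqs(2) using shift[of "1 + \<alpha>"] shift[of \<alpha>] ln a by (simp add: add.commute)
  thus ?A
    using const by (simp add: eqs(1))
  have "ln_Gamma (2 + \<beta>) = - 2 * ln \<alpha> + ln_Gamma (1 + \<beta>)"
    unfolding eqs(4) using shift[of "1 + \<beta>"] ln b by simp
  moreover have "ln_Gamma (2 - \<beta>) = ln \<alpha> + ln_Gamma \<alpha>"
    unfolding eqs(3) using shift[of \<alpha>] a by (simp add: add.commute)
  ultimately show ?B
    using const by simp
qed

section \<open>Fibonacci and Lucas weights\<close>

text \<open>
  The exponent \<open>2k + m\<close> splits as \<open>(m - 1) + (2k + 1)\<close>, so that a power with exponent \<open>m - 1\<close>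
  factors out of the odd power series; hence the index \<open>m - 1\<close> in the theorem.
\<close>

lemma odd_zeta_series_golden:
  fixes m :: int
  shows "(\<lambda>j. zeta_tail (2 * j + 3) * \<alpha> powi (2 * int j + 2 + m) / real (2 * j + 3))
           sums (\<alpha> powi (m - 1) * ((1 - euler_mascheroni) * \<alpha> + golden_log_const / 2))" (is ?A)
    and "(\<lambda>j. zeta_tail (2 * j + 3) * \<beta> powi (2 * int j + 2 + m) / real (2 * j + 3))
           sums (\<beta> powi (m - 1) * ((1 - euler_mascheroni) * \<beta> - golden_log_const / 2))" (is ?B)
proof -
  have shift: "x powi (2 * int j + 2 + m) = x powi (m - 1) * x ^ (2 * j + 3)"
    if "x \<noteq> 0" for x :: real and j
  proof -
    have "x powi (m - 1) * x ^ (2 * j + 3) = x powi (m - 1) * x powi (int (2 * j + 3))"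
      by (simp only: power_int_of_nat)
    also have "\<dots> = x powi (m - 1 + int (2 * j + 3))"
      using that by (subst power_int_add) simp_all
    also have "m - 1 + int (2 * j + 3) = 2 * int j + 2 + m"
      by simp
    finally show ?thesis ..
  qed
  have nonzero: "\<alpha> \<noteq> 0" "\<beta> \<noteq> 0"
    using golden_bounds by auto
  show ?A
    unfolding shift[OF nonzero(1)]
    using sums_mult[OF odd_zeta_power_series[of \<alpha>], of "\<alpha> powi (m - 1)"] golden_bounds
    by (simp add: ln_Gamma_golden_diff mult_ac)
  show ?B
    unfolding shift[OF nonzero(2)]
    using sums_mult[OF odd_zeta_power_series[of \<beta>], of "\<beta> powi (m - 1)"] golden_bounds
    by (simp add: ln_Gamma_golden_diff mult_ac)
qed

lemma powi_pred_mult: "\<alpha> powi (m - 1) * \<alpha> = \<alpha> powi m" "\<beta> powi (m - 1) * \<beta> = \<beta> powi m"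
  using golden_bounds by (simp_all add: power_int_diff)

lemma odd_zeta_fib_sums:
  "(\<lambda>j. zeta_tail (2 * j + 3) * (of_int (fib_int (2 * int j + 2 + m)) / real (2 * j + 3)))
     sums ((1 - euler_mascheroni) * of_int (fib_int m)
            + of_int (lucas_int (m - 1)) / (2 * sqrt 5) * golden_log_const)"
proof -
  have val: "(\<alpha> powi (m - 1) * ((1 - euler_mascheroni) * \<alpha> + golden_log_const / 2)
              - \<beta> powi (m - 1) * ((1 - euler_mascheroni) * \<beta> - golden_log_const / 2)) / sqrt 5
         = (1 - euler_mascheroni) * of_int (fib_int m)
            + of_int (lucas_int (m - 1)) / (2 * sqrt 5) * golden_log_const"
    unfolding fib_int_closed_form lucas_int_closed_form
      powi_pred_mult(1)[of m, symmetric] powi_pred_mult(2)[of m, symmetric]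
    by (simp add: field_simps)
  show ?thesis
    using sums_divide[OF sums_diff[OF odd_zeta_series_golden[of m]], of "sqrt 5"] unfolding val
    by (simp add: fib_int_closed_form diff_divide_distrib right_diff_distrib mult_ac)
qed

lemma odd_zeta_lucas_sums:
  "(\<lambda>j. zeta_tail (2 * j + 3) * (of_int (lucas_int (2 * int j + 2 + m)) / real (2 * j + 3)))
     sums ((1 - euler_mascheroni) * of_int (lucas_int m)
            + sqrt 5 * of_int (fib_int (m - 1)) / 2 * golden_log_const)"
proof -
  have val: "\<alpha> powi (m - 1) * ((1 - euler_mascheroni) * \<alpha> + golden_log_const / 2)
              + \<beta> powi (m - 1) * ((1 - euler_mascheroni) * \<beta> - golden_log_const / 2)
         = (1 - euler_mascheroni) * of_int (lucas_int m)
            + sqrt 5 * of_int (fib_int (m - 1)) / 2 * golden_log_const"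
    unfolding fib_int_closed_form lucas_int_closed_form
      powi_pred_mult(1)[of m, symmetric] powi_pred_mult(2)[of m, symmetric]
    by (simp add: field_simps)
  show ?thesis
    using sums_add[OF odd_zeta_series_golden[of m]] unfolding val
    by (simp add: lucas_int_closed_form add_divide_distrib distrib_left)
qed

theorem theorem3p2:
  fixes m :: int
  assumes "m \<ge> 0"
  shows
    "(\<lambda>j. let k = Suc j in
        (zeta (of_nat (2 * k + 1)) - 1)
          * (of_int (fib_int (2 * int k + m)) / of_nat (2 * k + 1)))
      sums complex_of_real
        ((1 - euler_mascheroni) * of_int (fib_int m)
          + of_int (lucas_int (m - 1)) / (2 * sqrt 5)
            * (ln (- pi * sec (sqrt 5 * pi / 2)) - 2 * ln (Gamma golden_ratio)
                - 4 * ln golden_ratio))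
     \<and>
     (\<lambda>j. let k = Suc j in
        (zeta (of_nat (2 * k + 1)) - 1)
          * (of_int (lucas_int (2 * int k + m)) / of_nat (2 * k + 1)))
      sums complex_of_real
        ((1 - euler_mascheroni) * of_int (lucas_int m)
          + sqrt 5 * of_int (fib_int (m - 1)) / 2
            * (ln (- pi * sec (sqrt 5 * pi / 2)) - 2 * ln (Gamma golden_ratio)
                - 4 * ln golden_ratio))"
proof -
  have real_form: "(\<lambda>j. let k = Suc j in
        (zeta (of_nat (2 * k + 1)) - 1) * (of_int (a (2 * int k + m)) / of_nat (2 * k + 1)))
      = (\<lambda>j. complex_of_real
          (zeta_tail (2 * j + 3) * (of_int (a (2 * int j + 2 + m)) / real (2 * j + 3))))"
    for a :: "int \<Rightarrow> int"
  proof
    fix j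
    have "2 * Suc j + 1 = 2 * j + 3" "2 * int (Suc j) + m = 2 * int j + 2 + m"
      by auto
    thus "(let k = Suc j in
        (zeta (of_nat (2 * k + 1)) - 1) * (of_int (a (2 * int k + m)) / of_nat (2 * k + 1)))
      = complex_of_real (zeta_tail (2 * j + 3) * (of_int (a (2 * int j + 2 + m)) / real (2 * j + 3)))"
      unfolding Let_def by (simp only: zeta_of_nat_minus_1) simp
  qed
  show ?thesis
    unfolding real_form
    by (intro conjI sums_of_real
          odd_zeta_fib_sums[unfolded golden_log_const_def]
          odd_zeta_lucas_sums[unfolded golden_log_const_def])
qed

end
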